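(* For every prime number $a$ with $a\equiv 1\pmod 4$ there exists a prime number $\beta$ with $\beta\equiv 3\pmod 4$ such that $a$ is a quadratic non-residue modulo $\beta$, i.e. $\left(\frac{a}{\beta}\right)=-1$.
   Context: $\left(\frac{a}{\beta}\right)$ denotes the Legendre symbol. *)

theory Defs
  imports "HOL-Number_Theory.Number_Theory"
begin

end

theory Submission
  imports Defs "HOL-Analysis.Harmonic_Numbers"
begin

text \<open>
  By quadratic reciprocity we need a prime \<open>p \<equiv> 3\<close> modulo 4 that is a non-residue modulo \<open>a\<close>.
  Let \<open>f\<close> be the non-principal character modulo 4 and \<open>g\<close> the Legendre symbol modulo \<open>a\<close>,
  restricted to odd numbers. If no such prime exists, then \<open>f p + g p \<ge> 0\<close> for all primes \<open>p\<close>,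
  so all local factors of the Dirichlet convolution \<open>h\<close> of \<open>f\<close> and \<open>g\<close> are nonnegative: \<open>h \<ge> 0\<close>
  everywhere and \<open>h \<ge> 1\<close> at odd squares. Hence the sums of \<open>h n / sqrt n\<close> over \<open>n \<le> Y\<^sup>2\<close>
  dominate the divergent sum of \<open>1 / j\<close> over odd \<open>j \<le> Y\<close>. On the other hand, both
  characters have bounded partial sums, so the Dirichlet hyperbola method bounds these sums
  independently of \<open>Y\<close>.
\<close>

section \<open>Summation by parts\<close>

text \<open>Abel summation writes the weighted sum as a combination of partial sums of
  \<open>f\<close> with nonnegative coefficients \<open>w k - w (Suc k)\<close> and
  \<open>w (Suc n)\<close>. These coefficients telescope to \<open>w (Suc m)\<close>.\<close>

lemma abs_sum_le_antimono_weight: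
  fixes f w :: "nat \<Rightarrow> real"
  assumes w: "\<And>i j. m < i \<Longrightarrow> i \<le> j \<Longrightarrow> w j \<le> w i" "\<And>i. m < i \<Longrightarrow> 0 \<le> w i"
    and bound: "\<And>n. \<bar>sum f {m<..n}\<bar> \<le> B"
  shows "\<bar>\<Sum>k\<in>{m<..n}. f k * w k\<bar> \<le> B * w (Suc m)"
proof (cases "m \<le> n")
  case True
  define P where "P = (\<lambda>n. sum f {m<..n})"
  have B: "0 \<le> B" using bound[of m] by simp
  have "(\<Sum>k\<in>{m<..n}. f k * w k) = P n * w (Suc n) + (\<Sum>k\<in>{m<..n}. P k * (w k - w (Suc k)))
      \<and> (\<Sum>k\<in>{m<..n}. w k - w (Suc k)) = w (Suc m) - w (Suc n)"
    using True
  proof (induction n rule: dec_induct)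
    case base
    show ?case by (simp add: P_def)
  next
    case (step n)
    have "{m<..Suc n} = insert (Suc n) {m<..n}" using step by auto
    then show ?case using step by (simp add: P_def algebra_simps)
  qed
  then have parts: "(\<Sum>k\<in>{m<..n}. f k * w k) = P n * w (Suc n) + (\<Sum>k\<in>{m<..n}. P k * (w k - w (Suc k)))"
    and tele: "(\<Sum>k\<in>{m<..n}. w k - w (Suc k)) = w (Suc m) - w (Suc n)" by auto
  have "\<bar>P n * w (Suc n)\<bar> \<le> B * w (Suc n)"
    using bound[of n] w(2)[of "Suc n"] True by (simp add: abs_mult P_def mult_right_mono)
  moreover have "\<bar>\<Sum>k\<in>{m<..n}. P k * (w k - w (Suc k))\<bar> \<le> (\<Sum>k\<in>{m<..n}. B * (w k - w (Suc k)))"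
  proof (rule order.trans[OF sum_abs sum_mono])
    fix k assume "k \<in> {m<..n}"
    then have "w (Suc k) \<le> w k" by (intro w) auto
    then show "\<bar>P k * (w k - w (Suc k))\<bar> \<le> B * (w k - w (Suc k))"
      using bound[of k] by (simp add: abs_mult P_def mult_right_mono)
  qed
  moreover have "(\<Sum>k\<in>{m<..n}. B * (w k - w (Suc k))) = B * (w (Suc m) - w (Suc n))"
    using tele by (simp add: sum_distrib_left[symmetric])
  ultimately show ?thesis using parts by (simp add: algebra_simps)
next
  case False
  then show ?thesis using bound[of m] w(2)[of "Suc m"] by simp
qed

lemma sum_inverse_sqrt_le: "(\<Sum>k=1..n. 1 / sqrt (real k)) \<le> 2 * sqrt (real n)"
proof (induction n)
  case (Suc n)
  have "1 / sqrt (real (Suc n)) \<le> 2 * sqrt (real (Suc n)) - 2 * sqrt (real n)"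
  proof -
    define s t where "s = sqrt (real (Suc n))" and "t = sqrt (real n)"
    have "s > 0" "s * s = real n + 1" "t * t = real n" by (auto simp: s_def t_def)
    \<comment> \<open>Combined with \<open>s * s = t * t + 1\<close>, this square gives 2s(s - t)
      \<ge> s * s - t * t = 1.\<close>
    moreover have "0 \<le> (s - t) * (s - t)" by simp
    ultimately have "1 \<le> (2 * s - 2 * t) * s" by (simp add: algebra_simps)
    with \<open>s > 0\<close> show ?thesis unfolding s_def[symmetric] t_def[symmetric]
      by (simp add: divide_simps)
  qed
  with Suc show ?case by simp
qed simp

section \<open>Dirichlet convolution of completely multiplicative functions\<close>

definition dconv :: "(nat \<Rightarrow> real) \<Rightarrow> (nat \<Rightarrow> real) \<Rightarrow> nat \<Rightarrow> real" where
  "dconv f g n = (\<Sum>d | d dvd n. f d * g (n div d))"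

lemma dconv_1: "f 1 = 1 \<Longrightarrow> g 1 = 1 \<Longrightarrow> dconv f g 1 = 1"
  by (simp add: dconv_def)

lemma mult_fun_power:
  fixes f :: "nat \<Rightarrow> real"
  assumes "f 1 = 1" "\<And>m n. f (m * n) = f m * f n"
  shows "f (p ^ k) = f p ^ k"
  using assms by (induction k) auto

text \<open>Each divisor of \<open>p ^ k * m\<close> is uniquely \<open>p ^ i * e\<close> with
  \<open>i \<le> k\<close> and \<open>e dvd m\<close>. Complete multiplicativity then splits every
  summand into a power part and an \<open>m\<close> part.\<close>

lemma dconv_prime_power_mult:
  assumes f: "f 1 = 1" "\<And>m n. f (m * n) = f m * f n"
    and g: "g 1 = 1" "\<And>m n. g (m * n) = g m * g n"
    and p: "prime p" "\<not> p dvd m"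
  shows "dconv f g (p ^ k * m) = (\<Sum>i\<le>k. f p ^ i * g p ^ (k - i)) * dconv f g m"
proof -
  have p0: "p > 0" "m > 0" using p by (auto intro: prime_gt_0_nat gr0I)
  have "dconv f g (p ^ k * m) = (\<Sum>(i, e)\<in>{..k} \<times> {e. e dvd m}. (f p ^ i * g p ^ (k - i)) * (f e * g (m div e)))"
    unfolding dconv_def
  \<comment> \<open>The exponent \<open>i\<close> is recovered as the multiplicity of
    \<open>p\<close> in the divisor, because \<open>e\<close> divides \<open>m\<close> and so is
    prime to \<open>p\<close>.\<close>
  proof (rule sum.reindex_bij_witness[symmetric, where i = "\<lambda>d. (multiplicity p d, d div p ^ multiplicity p d)"
        and j = "\<lambda>(i, e). p ^ i * e"], goal_cases)
    case (1 a)
    then obtain i e where a: "a = (i, e)" "i \<le> k" "e dvd m" by auto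
    then have "\<not> p dvd e" using p dvd_trans by blast
    then have "multiplicity p (p ^ i * e) = i"
      using p by (intro multiplicity_eqI) auto
    then show ?case using a p0 by simp
  next
    case (2 a)
    then show ?case by (auto intro!: mult_dvd_mono le_imp_power_dvd)
  next
    case (3 d)
    then show ?case by (simp add: multiplicity_dvd)
  next
    case (4 d)
    then have d: "d dvd p ^ k * m" by simp
    then have "d \<noteq> 0" using p0 by (intro notI) auto
    then obtain y where y: "d = p ^ multiplicity p d * y" "\<not> p dvd y"
      using multiplicity_decompose'[of d p] p by (metis not_prime_unit)
    have "coprime y (p ^ k)" using p y
      by (metis coprime_commute coprime_power_right_iff prime_imp_coprime_nat)
    moreover have "y dvd p ^ k * m" using d y by (metis dvd_mult_right)
    ultimately have "y dvd m" by (metis coprime_dvd_mult_right_iff)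
    moreover have "multiplicity p d \<le> k"
    proof -
      have "multiplicity p d \<le> multiplicity p (p ^ k * m)"
        using d p0 by (intro dvd_imp_multiplicity_le) auto
      also have "\<dots> = k" using p by (intro multiplicity_eqI) auto
      finally show ?thesis .
    qed
    moreover have "d div p ^ multiplicity p d = y" using y p0
      by (metis nonzero_mult_div_cancel_left not_gr_zero power_not_zero)
    ultimately show ?case by simp
  next
    case (5 a)
    then obtain i e where a: "a = (i, e)" "i \<le> k" "e dvd m" by auto
    then obtain e' where e': "m = e * e'" by auto
    with p0 have e0: "e > 0" by auto
    have "p ^ k * m = (p ^ i * e) * (p ^ (k - i) * e')"
      using a e' by (simp add: algebra_simps flip: power_add)
    then have "p ^ k * m div (p ^ i * e) = p ^ (k - i) * e'"
      using p0 e0 by simp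
    then show ?case using a e' e0 by (simp add: f(2) g(2) mult_fun_power[OF f] mult_fun_power[OF g])
  qed
  also have "\<dots> = (\<Sum>i\<le>k. f p ^ i * g p ^ (k - i)) * dconv f g m"
    unfolding dconv_def sum_product sum.cartesian_product by (simp add: case_prod_beta)
  finally show ?thesis .
qed

lemma sum_alternating: "(\<Sum>i\<le>k. (-1) ^ i :: real) = (if even k then 1 else 0)"
  by (induction k) auto

text \<open>The condition \<open>x + y \<ge> 0\<close> leaves six pairs. The sum is
  \<open>0 ^ k\<close> if both values vanish, 1 for {0, 1}, \<open>k + 1\<close> for two ones, and
  an alternating sum of signs for {1, -1}.\<close>

lemma local_factor:
  fixes x y :: real
  assumes "x \<in> {-1, 0, 1}" "y \<in> {-1, 0, 1}" "x + y \<ge> 0"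
  shows "(\<Sum>i\<le>k. x ^ i * y ^ (k - i)) \<ge> 0"
    and "even k \<Longrightarrow> x \<noteq> 0 \<or> y \<noteq> 0 \<Longrightarrow> (\<Sum>i\<le>k. x ^ i * y ^ (k - i)) \<ge> 1"
proof -
  have swap: "(\<Sum>i\<le>k. x ^ i * y ^ (k - i)) = (\<Sum>i\<le>k. y ^ i * x ^ (k - i))" for x y :: real
    by (rule sum.reindex_bij_witness[where i = "\<lambda>i. k - i" and j = "\<lambda>i. k - i"]) auto
  have zero: "(\<Sum>i\<le>k. x ^ i * 0 ^ (k - i)) = x ^ k" for x :: real
  proof -
    have "(\<Sum>i\<le>k. x ^ i * 0 ^ (k - i)) = (\<Sum>i\<in>{k}. x ^ i * 0 ^ (k - i))"
      by (rule sum.mono_neutral_right) auto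
    then show ?thesis by simp
  qed
  have ones: "(\<Sum>i\<le>k. (1::real) ^ i * 1 ^ (k - i)) = k + 1" by simp
  have alt: "(\<Sum>i\<le>k. (-1::real) ^ i * 1 ^ (k - i)) = (if even k then 1 else 0)"
    by (simp add: sum_alternating)
  consider "x = 0" "y = 0" | "x = 0" "y = 1" | "x = 1" "y = 0" | "x = 1" "y = 1"
    | "x = 1" "y = -1" | "x = -1" "y = 1"
    using assms by auto
  then have "(\<Sum>i\<le>k. x ^ i * y ^ (k - i)) \<ge> 0 \<and>
     (even k \<and> (x \<noteq> 0 \<or> y \<noteq> 0) \<longrightarrow> (\<Sum>i\<le>k. x ^ i * y ^ (k - i)) \<ge> 1)"
  proof cases
    case 1 then show ?thesis using zero[of 0] by simp
  next
    case 2 then show ?thesis using swap[of 0 1] zero[of 1] by (simp del: power_one)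
  next
    case 3 then show ?thesis using zero[of 1] by (simp del: power_one)
  next
    case 4 then show ?thesis using ones by simp
  next
    case 5 then show ?thesis using swap[of 1 "-1"] alt by (simp del: power_one)
  next
    case 6 then show ?thesis using alt by (simp del: power_one)
  qed
  then show "(\<Sum>i\<le>k. x ^ i * y ^ (k - i)) \<ge> 0"
    and "even k \<Longrightarrow> x \<noteq> 0 \<or> y \<noteq> 0 \<Longrightarrow> (\<Sum>i\<le>k. x ^ i * y ^ (k - i)) \<ge> 1" by auto
qed

section \<open>Real Dirichlet characters\<close>

text \<open>The witness \<open>c\<close> serves twice: \<open>f c = f 1 * f c\<close> forces
  \<open>f 1 = 1\<close>, and its invertibility modulo \<open>N\<close> makes the sum over a period
  vanish. \<open>N\<close> is a period and need not be the conductor.\<close>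

locale real_character =
  fixes f :: "nat \<Rightarrow> real" and N :: nat
  assumes N_pos: "N > 0"
    and trichotomous: "f n \<in> {-1, 0, 1}"
    and mult: "f (m * n) = f m * f n"
    and periodic: "f (n mod N) = f n"
    and nontrivial: "\<exists>c. coprime c N \<and> f c = -1"
begin

lemma one: "f 1 = 1"
proof -
  obtain c where "f c = -1" using nontrivial by blast
  then show ?thesis using mult[of 1 c] by simp
qed

lemma abs_le_1: "\<bar>f n\<bar> \<le> 1"
  using trichotomous[of n] by auto

text \<open>Multiplication by \<open>c\<close> permutes the residues modulo \<open>N\<close> and
  flips the sign of \<open>f\<close>, so the sum equals its own negative.\<close>

lemma sum_period: "sum f {..<N} = 0"
proof -
  obtain c where c: "coprime c N" "f c = -1" using nontrivial by blast
  have inj: "inj_on (\<lambda>n. (c * n) mod N) {..<N}"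
  proof (rule inj_onI)
    fix x y assume xy: "x \<in> {..<N}" "y \<in> {..<N}" "(c * x) mod N = (c * y) mod N"
    then have "[x = y] (mod N)" using c cong_mult_lcancel_nat[of c N x y] by (simp add: cong_def)
    then show "x = y" using xy by (simp add: cong_def)
  qed
  then have "(\<lambda>n. (c * n) mod N) ` {..<N} = {..<N}"
    using N_pos by (intro endo_inj_surj) auto
  then have "bij_betw (\<lambda>n. (c * n) mod N) {..<N} {..<N}" using inj by (simp add: bij_betw_def)
  then have "sum f {..<N} = (\<Sum>n<N. f ((c * n) mod N))"
    by (rule sum.reindex_bij_betw[symmetric])
  also have "\<dots> = - sum f {..<N}" by (simp add: periodic mult c sum_negf)
  finally show ?thesis by simp
qed

text \<open>Full periods contribute 0 and can be stripped off one at a time. Fewer than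
  \<open>N\<close> terms of absolute value at most 1 remain.\<close>

lemma abs_sum_lessThan: "\<bar>sum f {..<n}\<bar> \<le> N"
proof (induction n rule: less_induct)
  case (less n)
  show ?case
  proof (cases "n < N")
    case True
    have "\<bar>sum f {..<n}\<bar> \<le> (\<Sum>i<n. 1)"
      by (rule order.trans[OF sum_abs sum_mono]) (rule abs_le_1)
    then show ?thesis using True by simp
  next
    case False
    have "sum f {0 + N..<(n - N) + N} = (\<Sum>i=0..<n - N. f (i + N))"
      by (rule sum.shift_bounds_nat_ivl)
    also have "(\<lambda>i. f (i + N)) = f"
    proof
      show "f (i + N) = f i" for i using periodic[of "i + N"] periodic[of i] by simp
    qed
    finally have "sum f {N..<n} = sum f {..<n - N}"
      using False by (simp add: atLeast0LessThan)
    moreover have "sum f {..<n} = sum f {..<N} + sum f {N..<n}"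
      using False by (simp add: lessThan_atLeast0 sum.atLeastLessThan_concat)
    ultimately show ?thesis using less[of "n - N"] False N_pos sum_period by simp
  qed
qed

lemma abs_sum_interval: "\<bar>sum f {m<..n}\<bar> \<le> 2 * N"
proof (cases "m \<le> n")
  case True
  have "sum f {..<Suc n} = sum f {..<Suc m} + sum f {Suc m..<Suc n}"
    using True by (simp add: lessThan_atLeast0 sum.atLeastLessThan_concat del: sum.op_ivl_Suc)
  moreover have "{Suc m..<Suc n} = {m<..n}" by auto
  ultimately show ?thesis using abs_sum_lessThan[of "Suc n"] abs_sum_lessThan[of "Suc m"]
    by (simp only: abs_le_iff of_nat_mult of_nat_numeral) linarith
qed simp

text \<open>Summation by parts with the decreasing weight 1 / sqrt k. The bound is uniform in the
  upper limit \<open>n\<close>, as the varying ends of the hyperbola arms require.\<close>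

lemma abs_weighted_sum:
  assumes "m \<ge> y"
  shows "\<bar>\<Sum>k\<in>{m<..n}. f k / sqrt k\<bar> \<le> 2 * N / sqrt (Suc y)"
proof -
  have "\<bar>\<Sum>k\<in>{m<..n}. f k * (1 / sqrt k)\<bar> \<le> 2 * N * (1 / sqrt (Suc m))"
    by (rule abs_sum_le_antimono_weight[OF _ _ abs_sum_interval]) (auto intro!: divide_left_mono)
  also have "\<dots> \<le> 2 * N * (1 / sqrt (Suc y))"
    using assms by (intro mult_left_mono divide_left_mono) auto
  finally show ?thesis by simp
qed

lemma sum_abs_weighted_le: "(\<Sum>k=1..n. \<bar>f k / sqrt k\<bar>) \<le> 2 * sqrt n"
proof -
  have "(\<Sum>k=1..n. \<bar>f k / sqrt k\<bar>) \<le> (\<Sum>k=1..n. 1 / sqrt (real k))"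
    using abs_le_1 by (intro sum_mono) (auto intro: divide_right_mono)
  then show ?thesis using sum_inverse_sqrt_le[of n] by linarith
qed

end

section \<open>The Dirichlet hyperbola method\<close>

text \<open>The sum runs over the lattice points under the hyperbola mk = Y^2. Since one coordinate
  is at most \<open>Y\<close>, these points form a square \<open>A\<close> and two arms
  \<open>B\<close> and \<open>C\<close>, mirror images of each other.\<close>

lemma sum_hyperbola:
  fixes u v :: "nat \<Rightarrow> real"
  shows "(\<Sum>n=1..Y\<^sup>2. \<Sum>d | d dvd n. u d * v (n div d)) =
    (\<Sum>m=1..Y. u m) * (\<Sum>k=1..Y. v k)
    + (\<Sum>m=1..Y. u m * (\<Sum>k\<in>{Y<..Y\<^sup>2 div m}. v k))
    + (\<Sum>k=1..Y. v k * (\<Sum>m\<in>{Y<..Y\<^sup>2 div k}. u m))"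
proof -
  define F where "F = (\<lambda>(m, k). u m * v k)"
  define A where "A = {1..Y} \<times> {1..Y}"
  define B where "B = (SIGMA m:{1..Y}. {Y<..Y\<^sup>2 div m})"
  define C where "C = (\<lambda>(k, m). (m, k)) ` B"
  have fin: "finite A" "finite B" "finite C" by (auto simp: A_def B_def C_def)
  have mem_B: "(m, k) \<in> B \<longleftrightarrow> 1 \<le> m \<and> m \<le> Y \<and> Y < k \<and> m * k \<le> Y\<^sup>2" for m k
    by (auto simp: B_def less_eq_div_iff_mult_less_eq mult.commute)
  have mem_C: "(m, k) \<in> C \<longleftrightarrow> (k, m) \<in> B" for m k
    by (force simp: C_def)
  have le_Y: "m \<le> Y \<or> k \<le> Y" if "m * k \<le> Y\<^sup>2" for m k
  proof (rule ccontr)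
    assume "\<not> (m \<le> Y \<or> k \<le> Y)"
    then have "Y * Y < m * k" by (intro mult_strict_mono) auto
    with that show False by (simp add: power2_eq_square)
  qed
  have union: "{(m, k). 1 \<le> m \<and> 1 \<le> k \<and> m * k \<le> Y\<^sup>2} = A \<union> B \<union> C"
  proof (intro subset_antisym subsetI)
    fix x assume "x \<in> {(m, k). 1 \<le> m \<and> 1 \<le> k \<and> m * k \<le> Y\<^sup>2}"
    then obtain m k where x: "x = (m, k)" "1 \<le> m" "1 \<le> k" "m * k \<le> Y\<^sup>2" by auto
    then consider "m \<le> Y" "k \<le> Y" | "m \<le> Y" "Y < k" | "k \<le> Y" "Y < m"
      using le_Y[of m k] by linarith
    then show "x \<in> A \<union> B \<union> C"
      using x by cases (auto simp: A_def mem_B mem_C mult.commute)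
  next
    fix x assume "x \<in> A \<union> B \<union> C"
    then show "x \<in> {(m, k). 1 \<le> m \<and> 1 \<le> k \<and> m * k \<le> Y\<^sup>2}"
      by (cases x) (auto simp: A_def mem_B mem_C mult.commute power2_eq_square intro: mult_le_mono)
  qed
  have disj: "A \<inter> B = {}" "(A \<union> B) \<inter> C = {}"
    by (auto simp: A_def mem_B mem_C)
  have "(\<Sum>n=1..Y\<^sup>2. \<Sum>d | d dvd n. u d * v (n div d)) =
      (\<Sum>(n, d)\<in>(SIGMA n:{1..Y\<^sup>2}. {d. d dvd n}). u d * v (n div d))"
    by (rule sum.Sigma) auto
  also have "\<dots> = sum F {(m, k). 1 \<le> m \<and> 1 \<le> k \<and> m * k \<le> Y\<^sup>2}"
    \<comment> \<open>A number with a chosen divisor corresponds to the pair of complementary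
      divisors.\<close>
    by (rule sum.reindex_bij_witness[where j = "\<lambda>(n, d). (d, n div d)" and i = "\<lambda>(m, k). (m * k, m)"])
      (auto simp: F_def elim!: dvdE intro!: Suc_leI)
  also have "\<dots> = sum F A + sum F B + sum F C"
    unfolding union using fin disj by (simp add: sum.union_disjoint)
  also have "sum F A = (\<Sum>m=1..Y. u m) * (\<Sum>k=1..Y. v k)"
    by (simp add: A_def F_def sum_product sum.cartesian_product)
  also have "sum F B = (\<Sum>m=1..Y. u m * (\<Sum>k\<in>{Y<..Y\<^sup>2 div m}. v k))"
    by (simp add: B_def F_def sum_distrib_left sum.Sigma)
  also have "sum F C = (\<Sum>(k, m)\<in>B. u m * v k)"
    unfolding C_def F_def by (subst sum.reindex) (auto simp: inj_on_def case_prod_beta)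
  also have "\<dots> = (\<Sum>k=1..Y. v k * (\<Sum>m\<in>{Y<..Y\<^sup>2 div k}. u m))"
    by (simp add: B_def sum_distrib_left sum.Sigma mult.commute)
  finally show ?thesis .
qed

text \<open>As sqrt is multiplicative, dividing by \<open>sqrt n\<close> turns the convolution of
  \<open>f\<close> and \<open>g\<close> into that of \<open>u\<close> and \<open>v\<close>. The
  square contributes at most 2M * 2N, the arms at most 4N and 4M.\<close>

lemma sum_dconv_bounded:
  assumes "real_character f M" "real_character g N"
  shows "(\<Sum>n=1..Y\<^sup>2. dconv f g n / sqrt n) \<le> 4 * M * N + 4 * M + 4 * N"
proof -
  interpret f: real_character f M by fact
  interpret g: real_character g N by fact
  define u where "u = (\<lambda>k. f k / sqrt k)"
  define v where "v = (\<lambda>k. g k / sqrt k)"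
  \<comment> \<open>One estimate for both arms, used again with \<open>u\<close> and
    \<open>v\<close> exchanged; \<open>c\<close> is the modulus of the character in the inner sum.
    The growth \<open>2 * sqrt Y\<close> of the outer sum cancels the decay of the inner
    tail.\<close>
  have cross: "(\<Sum>m=1..Y. u m * (\<Sum>k\<in>{Y<..Y\<^sup>2 div m}. v k)) \<le> 4 * c"
    if u: "(\<Sum>m=1..Y. \<bar>u m\<bar>) \<le> 2 * sqrt Y"
      and v: "\<And>n. \<bar>\<Sum>k\<in>{Y<..n}. v k\<bar> \<le> 2 * c / sqrt (Suc Y)"
      and c: "c \<ge> 0" for u v :: "nat \<Rightarrow> real" and c :: real
  proof -
    have "(\<Sum>m=1..Y. u m * (\<Sum>k\<in>{Y<..Y\<^sup>2 div m}. v k)) \<le> (\<Sum>m=1..Y. \<bar>u m\<bar> * (2 * c / sqrt (Suc Y)))"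
    proof (rule sum_mono)
      fix m
      have "u m * (\<Sum>k\<in>{Y<..Y\<^sup>2 div m}. v k) \<le> \<bar>u m\<bar> * \<bar>\<Sum>k\<in>{Y<..Y\<^sup>2 div m}. v k\<bar>"
        by (metis abs_ge_self abs_mult)
      also have "\<dots> \<le> \<bar>u m\<bar> * (2 * c / sqrt (Suc Y))"
        by (intro mult_left_mono v) auto
      finally show "u m * (\<Sum>k\<in>{Y<..Y\<^sup>2 div m}. v k) \<le> \<bar>u m\<bar> * (2 * c / sqrt (Suc Y))" .
    qed
    also have "\<dots> = (\<Sum>m=1..Y. \<bar>u m\<bar>) * (2 * c / sqrt (Suc Y))"
      by (simp only: sum_distrib_right)
    also have "\<dots> \<le> 2 * sqrt Y * (2 * c / sqrt (Suc Y))"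
      using u c by (intro mult_right_mono) auto
    also have "\<dots> = 4 * c * (sqrt Y / sqrt (Suc Y))" by simp
    also have "\<dots> \<le> 4 * c * 1" using c by (intro mult_left_mono) auto
    finally show ?thesis by simp
  qed
  have set: "{Suc 0..Y} = {0<..Y}" by auto
  have "(\<Sum>n=1..Y\<^sup>2. dconv f g n / sqrt n) = (\<Sum>n=1..Y\<^sup>2. \<Sum>d | d dvd n. u d * v (n div d))"
  proof (rule sum.cong[OF refl])
    fix n assume "n \<in> {1..Y\<^sup>2}"
    show "dconv f g n / sqrt n = (\<Sum>d | d dvd n. u d * v (n div d))"
      unfolding dconv_def sum_divide_distrib
      by (rule sum.cong) (auto simp: u_def v_def real_sqrt_mult elim!: dvdE)
  qed
  also have "\<dots> = (\<Sum>m=1..Y. u m) * (\<Sum>k=1..Y. v k)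
    + (\<Sum>m=1..Y. u m * (\<Sum>k\<in>{Y<..Y\<^sup>2 div m}. v k))
    + (\<Sum>k=1..Y. v k * (\<Sum>m\<in>{Y<..Y\<^sup>2 div k}. u m))"
    by (rule sum_hyperbola)
  also have "\<dots> \<le> (2 * real M) * (2 * real N) + 4 * real N + 4 * real M"
  proof (intro add_mono cross)
    have "\<bar>\<Sum>m=1..Y. u m\<bar> \<le> 2 * real M" "\<bar>\<Sum>k=1..Y. v k\<bar> \<le> 2 * real N"
      using f.abs_weighted_sum[of 0 0 Y] g.abs_weighted_sum[of 0 0 Y] by (simp_all add: set u_def v_def)
    then have "\<bar>\<Sum>m=1..Y. u m\<bar> * \<bar>\<Sum>k=1..Y. v k\<bar> \<le> (2 * real M) * (2 * real N)"
      by (intro mult_mono) auto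
    then show "(\<Sum>m=1..Y. u m) * (\<Sum>k=1..Y. v k) \<le> (2 * real M) * (2 * real N)"
      by (metis abs_ge_self abs_mult order.trans)
  qed (use f.sum_abs_weighted_le[of Y] g.sum_abs_weighted_le[of Y]
      f.abs_weighted_sum[of Y Y] g.abs_weighted_sum[of Y Y] in \<open>auto simp: u_def v_def\<close>)
  finally show ?thesis by simp
qed

section \<open>Divergence over odd squares and the resulting prime\<close>

text \<open>Comparing 1 / (2i - 1) with 1 / (2i) bounds the sum below by half a harmonic
  number.\<close>

lemma sum_odd_inverse_unbounded: "\<exists>n. B < (\<Sum>j | j \<in> {1..n} \<and> odd j. 1 / real j)"
proof -
  have "\<exists>n. harm n > 2 * B"
    using harm_at_top unfolding filterlim_at_top_dense eventually_sequentially by blast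
  then obtain n where n: "harm n > 2 * B" by blast
  have "(\<Sum>i=1..n. 1 / real (2 * i)) = harm n / 2"
    by (simp add: harm_def sum_divide_distrib field_simps)
  then have "B < (\<Sum>i=1..n. 1 / real (2 * i))"
    using n by simp
  also have "\<dots> \<le> (\<Sum>i=1..n. 1 / real (2 * i - 1))"
    by (intro sum_mono divide_left_mono) auto
  also have "\<dots> = (\<Sum>j\<in>(\<lambda>i. 2 * i - 1) ` {1..n}. 1 / real j)"
    by (subst sum.reindex) (auto simp: inj_on_def)
  also have "\<dots> \<le> (\<Sum>j | j \<in> {1..2 * n} \<and> odd j. 1 / real j)"
    by (rule sum_mono2) auto
  finally show ?thesis by blast
qed

text \<open>Otherwise the convolution is nonnegative, and at odd squares at least 1, because
  \<open>f\<close> and \<open>g\<close> never vanish together at an odd prime. The odd harmonic sum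
  then breaks the uniform bound.\<close>

lemma exists_prime_character_values:
  assumes "real_character f M" "real_character g N"
    and odd: "\<And>p. prime p \<Longrightarrow> odd p \<Longrightarrow> f p \<noteq> 0 \<or> g p \<noteq> 0"
  shows "\<exists>p. prime p \<and> f p + g p < 0"
proof (rule ccontr)
  assume "\<not> ?thesis"
  then have pos: "f p + g p \<ge> 0" if "prime p" for p using that by (meson not_le)
  interpret f: real_character f M by fact
  interpret g: real_character g N by fact
  note split = dconv_prime_power_mult[OF f.one f.mult g.one g.mult]
  note loc = local_factor[OF f.trichotomous g.trichotomous pos]
  \<comment> \<open>Splitting off a full prime power leaves a smaller cofactor prime to
    \<open>p\<close>; both inductions below descend along it.\<close>
  have decomp: "\<exists>p k m. prime p \<and> \<not> p dvd m \<and> n = p ^ k * m \<and> m < n \<and> m > 0" if n: "n > 1" for n :: nat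
  proof -
    obtain p where p: "prime p" "p dvd n" using n prime_factor_nat[of n] by auto
    obtain y where y: "n = p ^ multiplicity p n * y" "\<not> p dvd y"
      using multiplicity_decompose'[of n p] p n by (metis not_prime_unit not_one_less_zero)
    have "multiplicity p n > 0" using p n by (intro prime_multiplicity_gt_zero_iff[THEN iffD2]) auto
    then have "p ^ multiplicity p n > 1" using p by (intro one_less_power prime_gt_1_nat)
    moreover have "y > 0" using y by (intro gr0I) auto
    ultimately have "y < n" by (subst y(1)) (rule n_less_m_mult_n, simp_all)
    with p y \<open>y > 0\<close> show ?thesis by blast
  qed
  have nonneg: "dconv f g n \<ge> 0" if "n > 0" for n
    using that
  proof (induction n rule: less_induct)
    case (less n)
    show ?case
    proof (cases "n = 1")
      case True
      then show ?thesis using dconv_1[of f g] f.one g.one by simp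
    next
      case False
      then obtain p k m where *: "prime p" "\<not> p dvd m" "n = p ^ k * m" "m < n" "m > 0"
        using decomp[of n] less.prems by auto
      then show ?thesis using less.IH[of m] loc(1)[of p] by (simp add: split)
    qed
  qed
  have square: "dconv f g (n\<^sup>2) \<ge> 1" if "odd n" for n
    using that
  proof (induction n rule: less_induct)
    case (less n)
    show ?case
    proof (cases "n = 1")
      case True
      then show ?thesis using dconv_1[of f g] f.one g.one by simp
    next
      case False
      then have "n > 1" using less.prems by (cases n) auto
      then obtain p k m where *: "prime p" "\<not> p dvd m" "n = p ^ k * m" "m < n" "m > 0"
        using decomp[of n] by auto
      show ?thesis
      proof (cases "k = 0")
        case False
        then have "odd p" "odd m" using * less.prems by auto
        \<comment> \<open>Squaring doubles the exponent of \<open>p\<close>, so the sharper bound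
          for even exponents applies.\<close>
        then have 1: "1 \<le> (\<Sum>i\<le>2 * k. f p ^ i * g p ^ (2 * k - i))" "1 \<le> dconv f g (m\<^sup>2)"
          using loc(2)[of p "2 * k"] odd * less.IH[of m] by auto
        have "n\<^sup>2 = p ^ (2 * k) * m\<^sup>2" using * by (simp add: power_mult_distrib power_mult mult.commute)
        moreover have "\<not> p dvd m\<^sup>2" using * prime_dvd_power_nat by blast
        ultimately have "dconv f g (n\<^sup>2) = (\<Sum>i\<le>2 * k. f p ^ i * g p ^ (2 * k - i)) * dconv f g (m\<^sup>2)"
          using *(1) by (simp add: split)
        with 1 show ?thesis using mult_mono[OF 1] by simp
      \<comment> \<open>The exponent 0 would give \<open>m = n\<close>, against
        \<open>m < n\<close>.\<close>
      qed (use * in auto)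
    qed
  qed
  obtain Y where Y: "4 * real M * real N + 4 * real M + 4 * real N < (\<Sum>j | j \<in> {1..Y} \<and> odd j. 1 / real j)"
    using sum_odd_inverse_unbounded by blast
  also have "\<dots> \<le> (\<Sum>j | j \<in> {1..Y} \<and> odd j. dconv f g (j\<^sup>2) / sqrt (real (j\<^sup>2)))"
    using square by (intro sum_mono) (auto intro: divide_right_mono)
  also have "\<dots> = (\<Sum>n\<in>power2 ` {j. j \<in> {1..Y} \<and> odd j}. dconv f g n / sqrt n)"
    by (subst sum.reindex) (auto simp: inj_on_def)
  \<comment> \<open>Nonnegativity allows the terms at all other \<open>n\<close> to be
    added.\<close>
  also have "\<dots> \<le> (\<Sum>n=1..Y\<^sup>2. dconv f g n / sqrt n)"
    using nonneg by (intro sum_mono2) (auto intro: power_mono)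
  also have "\<dots> \<le> 4 * real M * real N + 4 * real M + 4 * real N"
    using sum_dconv_bounded[OF assms(1,2)] by simp
  finally show False by simp
qed

section \<open>The two characters\<close>

definition chi4 :: "nat \<Rightarrow> real" where
  "chi4 n = (if n mod 4 = 1 then 1 else if n mod 4 = 3 then -1 else 0)"

lemma real_character_chi4: "real_character chi4 4"
proof
  show "chi4 (m * n) = chi4 m * chi4 n" for m n
  proof -
    have "m mod 4 = 0 \<or> m mod 4 = 1 \<or> m mod 4 = 2 \<or> m mod 4 = 3"
      "n mod 4 = 0 \<or> n mod 4 = 1 \<or> n mod 4 = 2 \<or> n mod 4 = 3" by presburger+
    moreover have "(m * n) mod 4 = ((m mod 4) * (n mod 4)) mod 4" by (simp add: mod_mult_eq)
    ultimately show ?thesis unfolding chi4_def by (elim disjE) simp_all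
  qed
  show "\<exists>c. coprime c 4 \<and> chi4 c = -1"
    using coprime_Suc_right_nat[of 3] by (intro exI[of _ 3]) (simp add: chi4_def)
qed (auto simp: chi4_def)

section \<open>The Legendre symbol as a character\<close>

lemma Legendre_values: "Legendre a p \<in> {-1, 0, 1}"
  by (simp add: Legendre_def)

lemma Legendre_cong: "[a = b] (mod p) \<Longrightarrow> Legendre a p = Legendre b p"
  by (simp add: Legendre_def QuadRes_def cong_def)

text \<open>Euler's criterion gives the identity modulo \<open>p\<close>. The two sides differ by at
  most 2, which is less than \<open>p\<close>, so they agree.\<close>

lemma Legendre_mult:
  assumes p: "prime p" "p > 2"
  shows "Legendre (a * b) (int p) = Legendre a p * Legendre b p"
proof -
  have "[Legendre (a * b) p = a ^ ((p - 1) div 2) * b ^ ((p - 1) div 2)] (mod p)"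
    using euler_criterion[OF p, of "a * b"] by (simp only: power_mult_distrib)
  then have "[Legendre (a * b) p = Legendre a p * Legendre b p] (mod p)"
    using cong_mult[OF euler_criterion[OF p, of a] euler_criterion[OF p, of b]]
    by (simp only: cong_def)
  then have dvd: "int p dvd Legendre (a * b) p - Legendre a p * Legendre b p"
    by (simp add: cong_iff_dvd_diff)
  have "\<bar>x - y * z\<bar> \<le> 2"
    if "x \<in> {-1, 0, 1}" "y \<in> {-1, 0, 1}" "z \<in> {-1, 0, 1}" for x y z :: int
    using that by auto
  then have "\<bar>Legendre (a * b) p - Legendre a p * Legendre b p\<bar> \<le> 2"
    using Legendre_values by blast
  also have "2 < \<bar>int p\<bar>" using p by simp
  finally have "Legendre (a * b) p - Legendre a p * Legendre b p = 0"
    using dvd_imp_le_int[OF _ dvd] by (metis not_le)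
  then show ?thesis by simp
qed

text \<open>A primitive root works: by Euler's criterion, symbol 1 would make its order
  \<open>p - 1\<close> divide \<open>(p - 1) div 2\<close>.\<close>

lemma exists_Legendre_minus_one:
  assumes p: "prime p" "p > 2"
  shows "\<exists>c::nat. coprime c (2 * p) \<and> odd c \<and> Legendre (int c) (int p) = -1"
proof -
  obtain g where g: "residue_primroot p g"
    using prime_primitive_root_exists[of p] p by auto
  then have g': "coprime p g" "ord p g = p - 1" using p by (auto simp: residue_primroot_def totient_prime)
  have "Legendre (int g) (int p) \<noteq> 1"
  proof
    assume "Legendre (int g) (int p) = 1"
    then have "[int g ^ ((p - 1) div 2) = 1] (mod int p)"
      using euler_criterion[OF p, of "int g"] by (metis cong_sym)
    then have "[g ^ ((p - 1) div 2) = 1] (mod p)"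
      by (metis cong_int_iff of_nat_1 of_nat_power)
    then have "p - 1 dvd (p - 1) div 2" using g' ord_divides[of g] by metis
    then show False using p by (auto dest: dvd_imp_le)
  qed
  moreover have ndvd: "\<not> p dvd g" using g' p by (metis coprime_absorb_left not_prime_unit)
  then have "Legendre (int g) (int p) \<noteq> 0" by (auto simp: Legendre_def cong_0_iff)
  ultimately have L: "Legendre (int g) (int p) = -1" using Legendre_values[of "int g" p] by auto
  \<comment> \<open>Adding the odd number \<open>p\<close> changes the parity but not the residue
    class; an odd \<open>c\<close> is also coprime to \<open>2 * p\<close>.\<close>
  define c where "c = (if odd g then g else g + p)"
  have "odd p" using p prime_odd_nat by blast
  then have "odd c" by (simp add: c_def)
  moreover have "coprime c p"
    using p by (intro prime_imp_coprime_nat[THEN coprime_commute[THEN iffD1]]) (auto simp: c_def ndvd)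
  moreover have "Legendre (int c) (int p) = -1"
  proof -
    have "[int c = int g] (mod int p)" by (simp add: c_def cong_def)
    then show ?thesis using L by (simp only: Legendre_cong)
  qed
  ultimately show ?thesis by (intro exI[of _ c]) simp
qed

text \<open>Discarding even arguments avoids the case distinction on the Legendre symbol of \<open>2\<close>.\<close>
definition odd_Legendre :: "nat \<Rightarrow> nat \<Rightarrow> real" where
  "odd_Legendre p n = (if odd n then real_of_int (Legendre (int n) (int p)) else 0)"

text \<open>The modulus \<open>2 * p\<close> lets reduction preserve both the residue modulo
  \<open>p\<close> and the parity.\<close>

lemma real_character_odd_Legendre:
  assumes p: "prime p" "p > 2"
  shows "real_character (odd_Legendre p) (2 * p)"
proof
  show "0 < 2 * p" using p by simp
  show "odd_Legendre p n \<in> {-1, 0, 1}" for n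
    using Legendre_values[of "int n" p] by (auto simp: odd_Legendre_def)
  show "odd_Legendre p (m * n) = odd_Legendre p m * odd_Legendre p n" for m n
    by (simp add: odd_Legendre_def Legendre_mult[OF p])
  show "odd_Legendre p (n mod (2 * p)) = odd_Legendre p n" for n
  proof -
    have "[n mod (2 * p) = n] (mod p)"
      by (simp add: cong_def mod_mod_cancel)
    then have "Legendre (int (n mod (2 * p))) (int p) = Legendre (int n) (int p)"
      by (intro Legendre_cong) (simp only: cong_int_iff)
    moreover have "odd (n mod (2 * p)) = odd n"
      by (simp add: dvd_mod_iff)
    ultimately show ?thesis by (simp add: odd_Legendre_def)
  qed
  show "\<exists>c. coprime c (2 * p) \<and> odd_Legendre p c = -1"
  proof -
    obtain c where "coprime c (2 * p)" "odd c" "Legendre (int c) (int p) = -1"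
      using exists_Legendre_minus_one[OF p] by blast
    then show ?thesis by (intro exI[of _ c]) (simp add: odd_Legendre_def)
  qed
qed

section \<open>Conclusion by quadratic reciprocity\<close>

theorem lemma1p1:
  fixes a :: nat
  assumes "prime a" and "[a = 1] (mod 4)"
  shows "\<exists>\<beta>::nat. prime \<beta> \<and> [\<beta> = 3] (mod 4) \<and> Legendre (int a) (int \<beta>) = -1"
proof -
  have a4: "a mod 4 = 1" using assms(2) by (simp add: cong_def)
  have a2: "a > 2" using a4 prime_gt_1_nat[OF assms(1)] by (cases "a = 2") auto
  have "\<exists>p. prime p \<and> chi4 p + odd_Legendre a p < 0"
  proof (rule exists_prime_character_values[OF real_character_chi4 real_character_odd_Legendre])
    fix p :: nat assume "odd p"
    then have "p mod 4 = 1 \<or> p mod 4 = 3" by presburger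
    then show "chi4 p \<noteq> 0 \<or> odd_Legendre a p \<noteq> 0" by (auto simp: chi4_def)
  qed (use assms a2 in auto)
  then obtain p where p: "prime p" and neg: "chi4 p + odd_Legendre a p < 0" by blast
  \<comment> \<open>Both characters vanish at even numbers, so their sum would be 0.\<close>
  have "odd p"
  proof
    assume "even p"
    then have "p mod 4 \<noteq> 1" "p mod 4 \<noteq> 3" by presburger+
    with neg \<open>even p\<close> show False by (simp add: chi4_def odd_Legendre_def)
  qed
  then have p2: "p > 2" using p prime_gt_1_nat[OF p] by (cases "p = 2") auto
  \<comment> \<open>At \<open>a\<close> the values are 1 and 0, whose sum is positive.\<close>
  have pa: "p \<noteq> a"
  proof
    assume "p = a"
    moreover have "Legendre (int a) (int a) = 0" by (simp add: Legendre_def cong_def)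
    ultimately show False using neg a4 by (simp add: chi4_def odd_Legendre_def split: if_splits)
  qed
  have "p mod 4 = 1 \<or> p mod 4 = 3" using \<open>odd p\<close> by presburger
  \<comment> \<open>A value 1 of either character would make the sum nonnegative, as the other is at
    least -1.\<close>
  then have p4: "p mod 4 = 3" and Lp: "Legendre (int p) (int a) \<noteq> 1"
    using neg \<open>odd p\<close> Legendre_values[of "int p" "int a"]
    by (auto simp: chi4_def odd_Legendre_def)
  have "\<not> a dvd p" using p assms(1) pa primes_dvd_imp_eq by blast
  then have "Legendre (int p) (int a) = -1"
    using Lp Legendre_values[of "int p" "int a"] by (auto simp: Legendre_def cong_0_iff)
  moreover have "Legendre (int p) (int a) * Legendre (int a) (int p) = 1"
  proof -
    \<comment> \<open>This evenness makes the sign in the reciprocity law +1.\<close>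
    have "even ((a - 1) div 2)" using a4 by presburger
    then show ?thesis
      using Quadratic_Reciprocity[OF p p2 assms(1) a2 pa] by simp
  qed
  ultimately show ?thesis using p p4 by (auto simp: cong_def)
qed

end
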